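(* Let $k$ be an algebraically closed field of characteristic zero, let $P=k[x_1,\ldots,x_n]$, let $I\subsetneq P$ be a proper ideal generated by monomials (of arbitrary degrees), and let $R=P/I$. Let $d>0$ be an integer. Suppose there is a nonempty Zariski open set $\mathcal U\subseteq k^n$ such that for every $(a_1,\ldots,a_n)\in\mathcal U$, with $\ell=\sum_{i=1}^n a_ix_i$, there exists $Q\in R_{d-1}$ such that $(\ell,Q)$ is a pair of exact zero divisors in $R$. Then $$\dim_k(R_d)=\dim_k(R_{d-1})-1.$$
   Context: $P=k[x_1,\ldots,x_n]$ has the standard grading, and $R_i$ denotes the degree-$i$ graded piece of $R=P/I$, i.e. the set of images of homogeneous polynomials of degree $i$ (including $0$). The same symbol denotes an element of $P$ and its image in $R$. A pair $(x,y)$ of elements of $R$ is a pair of exact zero divisors if $\mathrm{Ann}_R(x)=(y)$ and $\mathrm{Ann}_R(y)=(x)$, where $(x),(y)$ are the ideals of $R$ generated by $x,y$. *)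

theory Defs
  imports
    "HOL-Library.Poly_Mapping"
    "HOL-Algebra.QuotRing"
    "HOL-Algebra.Embedded_Algebras"
    "HOL-Algebra.Algebraic_Closure_Type"
begin

text \<open>
  The variables are indexed by a finite type \<open>'x\<close>, so \<open>n = CARD('x)\<close>.  A polynomial maps
  exponent vectors to coefficients, with finite support; multiplication on
  \<^typ>\<open>('x \<Rightarrow>\<^sub>0 nat) \<Rightarrow>\<^sub>0 'k\<close> is convolution.
\<close>

type_synonym ('x, 'k) mpoly = "('x \<Rightarrow>\<^sub>0 nat) \<Rightarrow>\<^sub>0 'k"

abbreviation mpoly_ring :: "('x::finite, 'k::field) mpoly ring"
  where "mpoly_ring \<equiv> ring_of_type_algebra"

definition monomial :: "('x \<Rightarrow>\<^sub>0 nat) \<Rightarrow> ('x::finite, 'k::field) mpoly"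
  where "monomial m = Poly_Mapping.single m 1"

definition const :: "'k \<Rightarrow> ('x::finite, 'k::field) mpoly"
  where "const c = Poly_Mapping.single 0 c"

definition var :: "'x \<Rightarrow> ('x::finite, 'k::field) mpoly"
  where "var i = monomial (Poly_Mapping.single i 1)"

definition monomial_degree :: "('x::finite \<Rightarrow>\<^sub>0 nat) \<Rightarrow> nat"
  where "monomial_degree m = (\<Sum>i\<in>UNIV. Poly_Mapping.lookup m i)"

definition homogeneous :: "nat \<Rightarrow> ('x::finite, 'k::field) mpoly \<Rightarrow> bool"
  where "homogeneous d p \<longleftrightarrow> (\<forall>m\<in>Poly_Mapping.keys p. monomial_degree m = d)"

definition mpoly_eval :: "('x::finite, 'k::field) mpoly \<Rightarrow> ('x \<Rightarrow> 'k) \<Rightarrow> 'k"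
  where "mpoly_eval p a =
    (\<Sum>m\<in>Poly_Mapping.keys p.
       Poly_Mapping.lookup p m * (\<Prod>i\<in>UNIV. a i ^ Poly_Mapping.lookup m i))"

definition zero_locus :: "('x::finite, 'k::field) mpoly set \<Rightarrow> ('x \<Rightarrow> 'k) set"
  where "zero_locus F = {a. \<forall>p\<in>F. mpoly_eval p a = 0}"

definition zariski_open :: "('x::finite \<Rightarrow> 'k::field) set \<Rightarrow> bool"
  where "zariski_open U \<longleftrightarrow> (\<exists>F. U = - zero_locus F)"

definition linear_form :: "('x::finite \<Rightarrow> 'k::field) \<Rightarrow> ('x, 'k) mpoly"
  where "linear_form a = (\<Sum>i\<in>UNIV. const (a i) * var i)"

definition monomial_ideal :: "('x::finite, 'k::field) mpoly set \<Rightarrow> bool"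
  where "monomial_ideal I \<longleftrightarrow> (\<exists>M. I = Idl\<^bsub>mpoly_ring\<^esub> (monomial ` M))"

definition annihilator :: "('a, 'b) ring_scheme \<Rightarrow> 'a \<Rightarrow> 'a set"
  where "annihilator R x = {y \<in> carrier R. x \<otimes>\<^bsub>R\<^esub> y = \<zero>\<^bsub>R\<^esub>}"

definition exact_zero_divisors :: "('a, 'b) ring_scheme \<Rightarrow> 'a \<Rightarrow> 'a \<Rightarrow> bool"
  where "exact_zero_divisors R x y \<longleftrightarrow>
    x \<in> carrier R \<and> y \<in> carrier R \<and>
    annihilator R x = PIdl\<^bsub>R\<^esub> y \<and> annihilator R y = PIdl\<^bsub>R\<^esub> x"

abbreviation residue_class ::
    "('x::finite, 'k::field) mpoly set \<Rightarrow> ('x, 'k) mpoly \<Rightarrow> ('x, 'k) mpoly set"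
  where "residue_class I p \<equiv> I +>\<^bsub>mpoly_ring\<^esub> p"

definition graded_piece ::
    "('x::finite, 'k::field) mpoly set \<Rightarrow> nat \<Rightarrow> ('x, 'k) mpoly set set"
  where "graded_piece I d = residue_class I ` {p. homogeneous d p}"

text \<open>
  \<^const>\<open>ring.dim\<close> takes scalars from a subfield of the ring; for a proper ideal \<open>I\<close> the
  classes of the constants form a copy of \<open>k\<close> inside \<open>P/I\<close>.
\<close>

definition scalars :: "('x::finite, 'k::field) mpoly set \<Rightarrow> ('x, 'k) mpoly set set"
  where "scalars I = residue_class I ` range const"

definition graded_dim :: "('x::finite, 'k::field) mpoly set \<Rightarrow> nat \<Rightarrow> nat"
  where "graded_dim I d =
    ring.dim (mpoly_ring Quot I) (scalars I) (graded_piece I d)"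

end

theory Submission
  imports Defs
begin

text \<open>
  Choose \<open>a \<in> U\<close> with all coordinates nonzero, and let \<open>Q\<close> of degree \<open>d - 1\<close> be the partner of
  \<open>\<ell> = \<Sum> a\<^sub>i x\<^sub>i\<close>.  The kernel of multiplication by \<open>\<ell>\<close> on \<open>R\<^bsub>d-1\<^esub>\<close> is \<open>(Q)\<^bsub>d-1\<^esub> = k Q\<close>, a line,
  so everything rests on \<open>\<ell> R\<^bsub>d-1\<^esub> = R\<^sub>d\<close>; since \<open>Ann Q = (\<ell>)\<close>, this amounts to \<open>Q R\<^sub>d = 0\<close>.
  A monomial \<open>x\<^sup>M\<close> of \<open>Q R\<^sub>d\<close> has degree \<open>2d - 1\<close>.  If \<open>x\<^sup>M \<notin> I\<close>, then no divisor of \<open>x\<^sup>M\<close> is in \<open>I\<close>,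
  so the part of \<open>Q\<close> supported on the divisors of \<open>x\<^sup>M\<close> is killed by \<open>\<ell>\<close> in the complete
  intersection \<open>k[x]/(x\<^sub>i\<^bsup>M\<^sub>i+1\<^esup>)\<close>.  There \<open>\<ell>\<close> is the raising operator of an \<open>sl\<^sub>2\<close>-action whose
  weight on degree \<open>d - 1\<close> is \<open>-1\<close>, and a raising operator is injective on negative weights in
  characteristic zero; so that part of \<open>Q\<close> vanishes.
\<close>

section \<open>An \<open>sl\<^sub>2\<close>-action on coefficient functions\<close>

text \<open>The case split is essential: subtraction of exponents is truncated, so for
  \<open>m\<close> with i-th exponent 0 the term \<open>m - Poly_Mapping.single i 1\<close> would be
  \<open>m\<close> itself.\<close>

definition raise :: "('x::finite \<Rightarrow> 'k::field) \<Rightarrow> (('x \<Rightarrow>\<^sub>0 nat) \<Rightarrow> 'k) \<Rightarrow> ('x \<Rightarrow>\<^sub>0 nat) \<Rightarrow> 'k"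
  where "raise a q m = (\<Sum>i\<in>UNIV.
    if Poly_Mapping.lookup m i = 0 then 0 else a i * q (m - Poly_Mapping.single i 1))"

text \<open>
  The coefficients of \<^term>\<open>lower a M\<close> vanish where \<open>m\<^sub>i = M\<^sub>i\<close>, so this operator preserves
  restriction to the box \<open>m \<le> M\<close>; \<^term>\<open>raise a\<close> needs no truncation.
\<close>

definition lower ::
    "('x::finite \<Rightarrow> 'k::field) \<Rightarrow> ('x \<Rightarrow>\<^sub>0 nat) \<Rightarrow> (('x \<Rightarrow>\<^sub>0 nat) \<Rightarrow> 'k) \<Rightarrow> ('x \<Rightarrow>\<^sub>0 nat) \<Rightarrow> 'k"
  where "lower a M q m = (\<Sum>i\<in>UNIV.
    inverse (a i) * (of_nat (Poly_Mapping.lookup m i + 1) *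
      (of_nat (Poly_Mapping.lookup M i) - of_nat (Poly_Mapping.lookup m i))) *
    q (m + Poly_Mapping.single i 1))"

section \<open>Arithmetic of exponent vectors\<close>

lemma lookup_add_unit:
  "Poly_Mapping.lookup (m + Poly_Mapping.single i (Suc 0)) j =
    (if i = j then Poly_Mapping.lookup m j + 1 else Poly_Mapping.lookup m j)"
  by (simp add: lookup_add lookup_single when_def)

lemma lookup_minus_unit:
  "Poly_Mapping.lookup (m - Poly_Mapping.single i (Suc 0)) j =
    (if i = j then Poly_Mapping.lookup m j - 1 else Poly_Mapping.lookup m j)"
  by (simp add: lookup_minus lookup_single when_def)

lemma add_minus_unit_commute:
  assumes "Poly_Mapping.lookup m i \<noteq> 0"
  shows "m + Poly_Mapping.single j (Suc 0) - Poly_Mapping.single i (Suc 0) =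
    m - Poly_Mapping.single i (Suc 0) + Poly_Mapping.single j (Suc 0)"
  using assms by (intro poly_mapping_eqI) (auto simp: lookup_add lookup_minus lookup_single when_def)

lemma monomial_degree_add: "monomial_degree (m + n) = monomial_degree m + monomial_degree n"
  by (simp add: monomial_degree_def lookup_add sum.distrib)

lemma monomial_degree_single [simp]: "monomial_degree (Poly_Mapping.single i n) = n"
  by (simp add: monomial_degree_def lookup_single when_def)

lemma minus_unit_add_unit:
  assumes "Poly_Mapping.lookup m i \<noteq> 0"
  shows "m - Poly_Mapping.single i (Suc 0) + Poly_Mapping.single i (Suc 0) = m"
  using assms by (intro poly_mapping_eqI) (auto simp: lookup_add lookup_minus lookup_single when_def)

lemma monomial_degree_minus_unit:
  assumes "Poly_Mapping.lookup m i \<noteq> 0"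
  shows "Suc (monomial_degree (m - Poly_Mapping.single i (Suc 0))) = monomial_degree m"
  using monomial_degree_add[of "m - Poly_Mapping.single i (Suc 0)" "Poly_Mapping.single i (Suc 0)"]
    minus_unit_add_unit[OF assms] by simp

text \<open>This is the relation [E,F] = H of sl2. On monomials, \<open>raise\<close> is the sum
  over i of x_i^s -> a_i x_i^(s+1), and \<open>lower\<close> the sum of x_i^(s+1) -> (s+1)(M_i -
  s)/a_i x_i^s. Operators in different variables commute, and one variable contributes s(M_i - s +
  1) - (s+1)(M_i - s) = 2s - M_i.\<close>

lemma raise_lower_commutator:
  fixes a :: "'x::finite \<Rightarrow> 'k::field"
  assumes "\<And>i. a i \<noteq> 0"
  shows "raise a (lower a M q) m - lower a M (raise a q) m =
    (2 * of_nat (monomial_degree m) - of_nat (monomial_degree M)) * q m"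
proof -
  let ?l = Poly_Mapping.lookup and ?e = "\<lambda>i::'x. Poly_Mapping.single i (1::nat)"
  define c :: "('x \<Rightarrow>\<^sub>0 nat) \<Rightarrow> 'x \<Rightarrow> 'k"
    where "c n j = of_nat (?l n j + 1) * (of_nat (?l M j) - of_nat (?l n j))" for n j
  \<comment> \<open>In both \<open>A\<close> and \<open>B\<close> the index i belongs to raising and
    j to lowering, so the two double sums can be compared term by term.\<close>
  define A where "A i j = (if ?l m i = 0 then 0
    else a i * (inverse (a j) * c (m - ?e i) j * q (m - ?e i + ?e j)))" for i j
  define B where "B i j = inverse (a j) * c m j *
    (if ?l (m + ?e j) i = 0 then 0 else a i * q (m + ?e j - ?e i))" for i j
  have "raise a (lower a M q) m = (\<Sum>i\<in>UNIV. \<Sum>j\<in>UNIV. A i j)"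
    unfolding raise_def lower_def A_def c_def
    by (intro sum.cong refl) (auto simp: sum_distrib_left)
  moreover have "lower a M (raise a q) m = (\<Sum>i\<in>UNIV. \<Sum>j\<in>UNIV. B i j)"
    unfolding raise_def lower_def B_def c_def
    by (subst sum.swap, intro sum.cong refl) (simp add: sum_distrib_left)
  moreover have "A i j - B i j = (if i = j then (2 * of_nat (?l m i) - of_nat (?l M i)) * q m else 0)"
    for i j
  proof (cases "i = j")
    case True
    have B: "B i i = c m i * q m"
      using assms[of i] by (simp add: B_def lookup_add_unit field_simps)
    show ?thesis
    proof (cases "?l m i = 0")
      case True
      then show ?thesis using B \<open>i = j\<close> by (simp add: A_def c_def)
    next
      case False
      then have "A i i = c (m - ?e i) i * q m"
        using assms[of i] by (simp add: A_def minus_unit_add_unit mult.assoc[symmetric])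
      moreover have "c (m - ?e i) i - c m i = 2 * of_nat (?l m i) - of_nat (?l M i)"
        using False by (cases "?l m i") (simp_all add: c_def lookup_minus_unit algebra_simps)
      ultimately show ?thesis
        using B \<open>i = j\<close> by (metis left_diff_distrib)
    qed
  next
    case False
    then show ?thesis
      using add_minus_unit_commute[of m i j]
      by (simp add: A_def B_def c_def lookup_add_unit lookup_minus_unit)
  qed
  ultimately have "raise a (lower a M q) m - lower a M (raise a q) m =
      (\<Sum>i\<in>UNIV. (2 * of_nat (?l m i) - of_nat (?l M i)) * q m)"
    by (simp add: sum_subtractf[symmetric])
  then show ?thesis
    by (simp add: monomial_degree_def sum_subtractf sum_distrib_left flip: sum_distrib_right)
qed

text \<open>With E and F for \<open>raise\<close> and \<open>lower\<close>, the commutator turns E q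
  = 0 into E F^(j+1) q = -(j+1)^2 F^j q, so F^(j+1) q = 0 forces F^j q = 0. Each F lowers the degree
  by one, hence the powers of F vanish eventually, and descending gives q = 0. All of this is
  asserted only on the box below \<open>M\<close>.\<close>

lemma raise_kernel_below:
  fixes a :: "'x::finite \<Rightarrow> 'k::field_char_0"
  assumes a: "\<And>i. a i \<noteq> 0"
    and M: "Suc (monomial_degree M) = 2 * d"
    and ker: "\<And>m. \<lbrakk>\<And>i. Poly_Mapping.lookup m i \<le> Poly_Mapping.lookup M i; monomial_degree m = d\<rbrakk>
      \<Longrightarrow> raise a q m = 0"
    and m: "\<And>i. Poly_Mapping.lookup m i \<le> Poly_Mapping.lookup M i" "Suc (monomial_degree m) = d"
  shows "q m = 0"
proof -
  let ?below = "\<lambda>m. \<forall>i. Poly_Mapping.lookup m i \<le> Poly_Mapping.lookup M i"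
  let ?e = "\<lambda>i::'x. Poly_Mapping.single i (1::nat)"
  define F where "F j = (lower a M ^^ j) q" for j
  have F_Suc: "F (Suc j) = lower a M (F j)" for j
    by (simp add: F_def)
  have weight: "(2 * of_nat (monomial_degree m) - of_nat (monomial_degree M) :: 'k) = - (2 * of_nat j + 1)"
    if "monomial_degree m + j + 1 = d" for m j
  proof -
    have "2 * monomial_degree m + 2 * j + 1 = monomial_degree M"
      using that M by simp
    then have "(of_nat (monomial_degree M) :: 'k) = of_nat (2 * monomial_degree m + 2 * j + 1)"
      by simp
    then show ?thesis
      by simp
  qed
  \<comment> \<open>\<open>q\<close> is killed by the raising operator and \<open>F 0, F 1, \<dots>\<close> have weights \<open>-1, -3, \<dots>\<close>; the
    factor is their partial sum.\<close>
  have raise_F: "raise a (F (Suc j)) m = - of_nat ((j + 1)\<^sup>2) * F j m"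
    if "?below m" "monomial_degree m + j + 1 = d" for j m
    using that
  proof (induction j arbitrary: m)
    case 0
    have "inverse (a i) * (of_nat (Poly_Mapping.lookup m i + 1) *
        (of_nat (Poly_Mapping.lookup M i) - of_nat (Poly_Mapping.lookup m i))) * raise a (F 0) (m + ?e i) = 0" for i
    \<comment> \<open>On the face of the box where the i-th exponents agree, the coefficient in
      \<open>lower\<close> is zero; elsewhere \<open>m + ?e i\<close> is still in the box, has
      degree \<open>d\<close>, and \<open>ker\<close> applies.\<close>
    proof (cases "Poly_Mapping.lookup m i = Poly_Mapping.lookup M i")
      case False
      then have "?below (m + ?e i)"
        using 0(1) by (auto simp: lookup_add_unit Suc_le_eq order.not_eq_order_implies_strict)
      then show ?thesis
        using 0(2) ker[of "m + ?e i"] by (simp add: F_def monomial_degree_add)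
    qed simp
    then have "lower a M (raise a (F 0)) m = 0"
      unfolding lower_def by (intro sum.neutral) blast
    then show ?case
      using raise_lower_commutator[of a M "F 0" m, OF a] weight[of m 0] 0 by (simp add: F_Suc)
  next
    case (Suc j)
    have "inverse (a i) * (of_nat (Poly_Mapping.lookup m i + 1) *
        (of_nat (Poly_Mapping.lookup M i) - of_nat (Poly_Mapping.lookup m i))) * raise a (F (Suc j)) (m + ?e i) =
      - of_nat ((j + 1)\<^sup>2) * (inverse (a i) * (of_nat (Poly_Mapping.lookup m i + 1) *
        (of_nat (Poly_Mapping.lookup M i) - of_nat (Poly_Mapping.lookup m i))) * F j (m + ?e i))" for i
    proof (cases "Poly_Mapping.lookup m i = Poly_Mapping.lookup M i")
      case False
      then have "?below (m + ?e i)"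
        using Suc(2) by (auto simp: lookup_add_unit Suc_le_eq order.not_eq_order_implies_strict)
      then have "raise a (F (Suc j)) (m + ?e i) = - of_nat ((j + 1)\<^sup>2) * F j (m + ?e i)"
        using Suc(3) by (intro Suc.IH) (simp_all add: monomial_degree_add)
      then show ?thesis
        by (simp only: mult_ac)
    qed simp
    then have "lower a M (raise a (F (Suc j))) m = - of_nat ((j + 1)\<^sup>2) * F (Suc j) m"
      unfolding F_Suc[of j] lower_def sum_distrib_left by (intro sum.cong refl) (simp only: F_Suc lower_def)
    moreover have "raise a (F (Suc (Suc j))) m - lower a M (raise a (F (Suc j))) m =
        - (2 * of_nat (Suc j) + 1) * F (Suc j) m"
      using raise_lower_commutator[of a M "F (Suc j)" m, OF a] weight[of m "Suc j"] Suc(3)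
      by (simp add: F_Suc[of "Suc j"])
    ultimately have "raise a (F (Suc (Suc j))) m =
        - (2 * of_nat (Suc j) + 1) * F (Suc j) m + - of_nat ((j + 1)\<^sup>2) * F (Suc j) m"
      by (simp only: diff_eq_eq)
    then show ?case
      by (simp add: algebra_simps power2_eq_square)
  qed
  \<comment> \<open>Induction downwards from \<open>j = d\<close>, where the claim is vacuous
    because no degree satisfies the equation.\<close>
  have "\<forall>m. ?below m \<longrightarrow> monomial_degree m + j + 1 = d \<longrightarrow> F j m = 0" if "j \<le> d" for j
    using that
  proof (induction j rule: inc_induct)
    case base
    then show ?case by simp
  next
    case (step j)
    show ?case
    proof (intro allI impI)
      fix m assume m: "?below m" "monomial_degree m + j + 1 = d"
      have "F (Suc j) (m - ?e i) = 0" if "Poly_Mapping.lookup m i \<noteq> 0" for i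
      proof -
        have "?below (m - ?e i)"
          using m(1) le_diff_conv trans_le_add1 by (fastforce simp: lookup_minus_unit)
        then show ?thesis
          using step.IH m(2) monomial_degree_minus_unit[OF that] by simp
      qed
      then have "raise a (F (Suc j)) m = 0"
        unfolding raise_def by (intro sum.neutral) simp
      then have "of_nat ((j + 1)\<^sup>2) * F j m = 0"
        using raise_F[OF m] by simp
      \<comment> \<open>Characteristic zero: the image of a positive natural number is nonzero. The
        square is kept inside \<open>of_nat\<close> so that this applies directly.\<close>
      then show "F j m = 0"
        by (simp del: of_nat_power)
    qed
  qed
  from this[of 0] m show ?thesis
    by (simp add: F_def)
qed

section \<open>Monomial ideals\<close>

lemma lookup_single_times:
  fixes p :: "('x::finite, 'k::field) mpoly"
  shows "Poly_Mapping.lookup (Poly_Mapping.single t c * p) (t + m) = c * Poly_Mapping.lookup p m"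
proof -
  have "Poly_Mapping.lookup (Poly_Mapping.single t c * p) (t + m) =
      (\<Sum>l. (c when t = l) * (\<Sum>q. Poly_Mapping.lookup p q when t + m = l + q))"
    by (simp add: lookup_mult lookup_single)
  also have "\<dots> = c * (\<Sum>q. Poly_Mapping.lookup p q when t + m = t + q)"
    by (simp add: when_mult)
  also have "\<dots> = c * Poly_Mapping.lookup p m"
    by simp
  finally show ?thesis .
qed

lemma lookup_sum_poly_mapping: "Poly_Mapping.lookup (sum f A) m = (\<Sum>i\<in>A. Poly_Mapping.lookup (f i) m)"
  by (induction A rule: infinite_finite_induct) (simp_all add: lookup_add)

lemma lookup_var_times:
  "Poly_Mapping.lookup (var i * p) m =
    (if Poly_Mapping.lookup m i = 0 then 0 else Poly_Mapping.lookup p (m - Poly_Mapping.single i 1))"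
proof (cases "Poly_Mapping.lookup m i = 0")
  case True
  have "m \<notin> Poly_Mapping.keys (var i * p)"
  proof
    assume "m \<in> Poly_Mapping.keys (var i * p)"
    then obtain n where "m = Poly_Mapping.single i 1 + n"
      using keys_mult[of "var i" p] by (auto simp: var_def monomial_def)
    with True show False
      by (simp add: lookup_add)
  qed
  with True show ?thesis
    by (simp add: in_keys_iff)
next
  case False
  then have "m = Poly_Mapping.single i 1 + (m - Poly_Mapping.single i 1)"
    by (metis One_nat_def add.commute minus_unit_add_unit)
  then show ?thesis
    using False lookup_single_times[of "Poly_Mapping.single i 1" 1 p "m - Poly_Mapping.single i 1"]
    by (simp add: var_def monomial_def)
qed

lemma lookup_const_times: "Poly_Mapping.lookup (const c * p) m = c * Poly_Mapping.lookup p m"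
  using lookup_single_times[of 0 c p m] by (simp add: const_def)

text \<open>The bridge from the ring to the sl2-action: a kernel condition on polynomials becomes
  one on coefficient functions.\<close>

lemma lookup_linear_form_times:
  "Poly_Mapping.lookup (linear_form a * p) = raise a (Poly_Mapping.lookup p)"
  by (rule ext) (simp add: linear_form_def raise_def sum_distrib_right lookup_sum_poly_mapping mult.assoc
      lookup_const_times lookup_var_times if_distrib cong: if_cong)

text \<open>Every argument read by \<open>raise\<close> at \<open>m\<close> lies exactly one degree
  lower, which later allows a cofactor to be replaced by a homogeneous part.\<close>

lemma raise_cong:
  assumes "\<And>n. Suc (monomial_degree n) = monomial_degree m \<Longrightarrow> p n = q n"
  shows "raise a p m = raise a q m"
  unfolding raise_def using assms
  by (intro sum.cong refl) (simp add: monomial_degree_minus_unit)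

section \<open>Homogeneous polynomials and expansion into monomials\<close>

lemma monomial_degree_eq_0_iff [simp]: "monomial_degree m = 0 \<longleftrightarrow> m = 0"
  by (auto simp: monomial_degree_def intro: poly_mapping_eqI)

lemma homogeneous_minus: "homogeneous d p \<Longrightarrow> homogeneous d q \<Longrightarrow> homogeneous d (p - q)"
  using keys_diff[of p q] by (auto simp: homogeneous_def)

lemma homogeneous_mult:
  "homogeneous d p \<Longrightarrow> homogeneous e q \<Longrightarrow> homogeneous (d + e) (p * q)"
  using keys_mult[of p q] by (fastforce simp: homogeneous_def monomial_degree_add)

lemma homogeneous_linear_form: "homogeneous 1 (linear_form a)"
proof -
  have "homogeneous (0 + 1) (const c * var i)" for c i
    by (rule homogeneous_mult) (simp_all add: homogeneous_def const_def var_def monomial_def split: if_splits)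
  then show ?thesis
    unfolding linear_form_def homogeneous_def using keys_sum[of "\<lambda>i. const (a i) * var i" UNIV]
    by fastforce
qed

definition homogeneous_part :: "nat \<Rightarrow> ('x::finite, 'k::field) mpoly \<Rightarrow> ('x, 'k) mpoly"
  where "homogeneous_part d p = Poly_Mapping.mapp (\<lambda>m c. c when monomial_degree m = d) p"

lemma lookup_homogeneous_part:
  "Poly_Mapping.lookup (homogeneous_part d p) m = (Poly_Mapping.lookup p m when monomial_degree m = d)"
  by (simp add: homogeneous_part_def lookup_mapp when_def in_keys_iff)

lemma homogeneous_homogeneous_part: "homogeneous d (homogeneous_part d p)"
  by (auto simp: homogeneous_def in_keys_iff lookup_homogeneous_part when_def split: if_splits)

lemma finite_monomial_degree: "finite {m :: 'x::finite \<Rightarrow>\<^sub>0 nat. monomial_degree m = d}"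
proof (rule inj_on_finite[where f = Poly_Mapping.lookup and B = "{f. range f \<subseteq> {..d}}"])
  show "inj_on Poly_Mapping.lookup {m :: 'x \<Rightarrow>\<^sub>0 nat. monomial_degree m = d}"
    by (meson inj_on_def poly_mapping.lookup_inject)
  show "Poly_Mapping.lookup ` {m :: 'x \<Rightarrow>\<^sub>0 nat. monomial_degree m = d} \<subseteq> {f. range f \<subseteq> {..d}}"
    by (auto simp: monomial_degree_def intro: member_le_sum)
  show "finite {f :: 'x \<Rightarrow> nat. range f \<subseteq> {..d}}"
    using finite_PiE[of "UNIV :: 'x set" "\<lambda>_. {..d}"]
    by (simp add: PiE_def Pi_def image_subset_iff)
qed

lemma mpoly_eq_sum_monomials: "p = (\<Sum>m\<in>Poly_Mapping.keys p. const (Poly_Mapping.lookup p m) * monomial m)"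
  by (intro poly_mapping_eqI)
    (simp add: lookup_sum_poly_mapping lookup_const_times monomial_def lookup_single when_def in_keys_iff if_distrib sum.delta cong: if_cong)

section \<open>The polynomial ring and its ideals in terms of the type-class operations\<close>

lemma ring_of_type_algebra_simps [simp]:
  "carrier ring_of_type_algebra = UNIV"
  "p \<otimes>\<^bsub>ring_of_type_algebra\<^esub> q = p * q"
  "p \<oplus>\<^bsub>ring_of_type_algebra\<^esub> q = p + q"
  "\<zero>\<^bsub>ring_of_type_algebra\<^esub> = 0"
  "\<one>\<^bsub>ring_of_type_algebra\<^esub> = 1"
  by (simp_all add: ring_of_type_algebra_def)

lemma cring_mpoly_ring: "cring (mpoly_ring :: ('x::finite, 'k::field) mpoly ring)"
  by (rule cring_from_type_algebra)

lemma mpoly_ring_minus: "\<ominus>\<^bsub>mpoly_ring\<^esub> p = - p"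
proof -
  interpret cring "mpoly_ring :: ('a, 'b) mpoly ring" by (rule cring_mpoly_ring)
  show ?thesis
    using minus_equality[of "- p" p] by simp
qed

lemma mpoly_ring_diff: "p \<ominus>\<^bsub>mpoly_ring\<^esub> q = p - q"
  by (simp add: a_minus_def mpoly_ring_minus)

lemma mpoly_ideal_iff:
  "ideal I mpoly_ring \<longleftrightarrow>
    0 \<in> I \<and> (\<forall>p\<in>I. \<forall>q\<in>I. p + q \<in> I) \<and> (\<forall>p\<in>I. \<forall>q. q * p \<in> I)"
proof
  assume "ideal I mpoly_ring"
  then interpret ideal I mpoly_ring .
  show "0 \<in> I \<and> (\<forall>p\<in>I. \<forall>q\<in>I. p + q \<in> I) \<and> (\<forall>p\<in>I. \<forall>q. q * p \<in> I)"
    using additive_subgroup.zero_closed[OF is_additive_subgroup]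
      additive_subgroup.a_closed[OF is_additive_subgroup] I_l_closed by simp
next
  assume I: "0 \<in> I \<and> (\<forall>p\<in>I. \<forall>q\<in>I. p + q \<in> I) \<and> (\<forall>p\<in>I. \<forall>q. q * p \<in> I)"
  interpret cring "mpoly_ring :: ('a, 'b) mpoly ring" by (rule cring_mpoly_ring)
  have "- p \<in> I" if "p \<in> I" for p
    using I that by (metis mult_minus1)
  then show "ideal I mpoly_ring"
    using I by (intro idealI add.subgroupI)
      (auto simp: ring_axioms a_inv_def[symmetric] mpoly_ring_minus mult.commute)
qed

lemma monomial_ideal_ideal: "monomial_ideal I \<Longrightarrow> ideal I mpoly_ring"
proof -
  interpret cring "mpoly_ring :: ('a, 'b) mpoly ring" by (rule cring_mpoly_ring)
  show "monomial_ideal I \<Longrightarrow> ideal I mpoly_ring"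
    unfolding monomial_ideal_def using genideal_ideal by auto
qed

section \<open>Membership in monomial ideals\<close>

lemma monomial_add: "monomial (m + n) = monomial m * monomial n"
  by (simp add: monomial_def mult_single)

text \<open>The polynomials all of whose exponents are divisible by a generator form an ideal
  \<open>J\<close> containing the generators, so \<open>I\<close> is contained in \<open>J\<close>;
  and multiples of generators lie in \<open>I\<close>. Conversely a polynomial is the sum of its
  terms. Membership can thus be tested term by term.\<close>

lemma monomial_ideal_mem_iff:
  fixes I :: "('x::finite, 'k::field) mpoly set"
  assumes "monomial_ideal I"
  shows "p \<in> I \<longleftrightarrow> (\<forall>m\<in>Poly_Mapping.keys p. monomial m \<in> I)"
proof -
  interpret cring "mpoly_ring :: ('x, 'k) mpoly ring" by (rule cring_mpoly_ring)
  obtain M where M: "I = Idl\<^bsub>mpoly_ring\<^esub> (monomial ` M)"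
    using assms by (auto simp: monomial_ideal_def)
  note I = monomial_ideal_ideal[OF assms, unfolded mpoly_ideal_iff]
  define J where "J = {p :: ('x, 'k) mpoly. \<forall>m\<in>Poly_Mapping.keys p. \<exists>t\<in>M. \<exists>s. m = t + s}"
  have "ideal J mpoly_ring"
    unfolding mpoly_ideal_iff
  proof (intro conjI ballI allI)
    show "p + q \<in> J" if "p \<in> J" "q \<in> J" for p q
      using that Poly_Mapping.keys_add[of p q] by (auto simp: J_def)
    show "q * p \<in> J" if "p \<in> J" for p q
    proof -
      have "\<exists>t\<in>M. \<exists>s. m = t + s" if m: "m \<in> Poly_Mapping.keys (q * p)" for m
      proof -
        obtain u v where "m = u + v" "v \<in> Poly_Mapping.keys p"
          using m keys_mult[of q p] by blast
        then obtain t s where "t \<in> M" "v = t + s"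
          using \<open>p \<in> J\<close> unfolding J_def by blast
        then have "m = t + (u + s)"
          using \<open>m = u + v\<close> by (simp add: ac_simps)
        then show ?thesis
          using \<open>t \<in> M\<close> by blast
      qed
      then show ?thesis by (simp add: J_def)
    qed
  qed (simp add: J_def)
  moreover have "monomial ` M \<subseteq> J"
    by (force simp: J_def monomial_def)
  ultimately have "I \<subseteq> J"
    unfolding M by (rule genideal_minimal)
  moreover have "monomial (t + s) \<in> I" if "t \<in> M" for t s
  proof -
    have "monomial t \<in> I"
      using that genideal_self[of "monomial ` M"] by (auto simp: M)
    then show ?thesis
      unfolding add.commute[of t s] monomial_add using I by blast
  qed
  moreover have "\<exists>t\<in>M. \<exists>s. m = t + s" if "p \<in> J" "m \<in> Poly_Mapping.keys p" for m
    using that unfolding J_def by blast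
  ultimately have "monomial m \<in> I" if "p \<in> I" "m \<in> Poly_Mapping.keys p" for m
    using that by (metis subsetD)
  moreover have "p \<in> I" if "\<forall>m\<in>Poly_Mapping.keys p. monomial m \<in> I"
  proof -
    have terms: "const (Poly_Mapping.lookup p m) * monomial m \<in> I" if "m \<in> Poly_Mapping.keys p" for m
      using that \<open>\<forall>m\<in>Poly_Mapping.keys p. monomial m \<in> I\<close> I by blast
    have "(\<Sum>m\<in>A. const (Poly_Mapping.lookup p m) * monomial m) \<in> I"
      if "finite A" "A \<subseteq> Poly_Mapping.keys p" for A
      using that by (induction rule: finite_induct) (auto simp: I terms)
    from this[OF finite_keys order_refl] show ?thesis
      by (subst mpoly_eq_sum_monomials)
  qed
  ultimately show ?thesis by blast
qed

lemma monomial_ideal_memI: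
  assumes "monomial_ideal I" "\<And>m. m \<in> Poly_Mapping.keys p \<Longrightarrow> monomial m \<in> I"
  shows "p \<in> I"
  using assms monomial_ideal_mem_iff by blast

lemma monomial_ideal_memD:
  assumes "monomial_ideal I" "p \<in> I" "m \<in> Poly_Mapping.keys p"
  shows "monomial m \<in> I"
  using assms monomial_ideal_mem_iff by blast

lemma monomial_ideal_upward:
  assumes "monomial_ideal I" "monomial m \<in> I"
    and "\<And>i. Poly_Mapping.lookup m i \<le> Poly_Mapping.lookup n i"
  shows "monomial n \<in> I"
proof -
  have "n = (n - m) + m"
    using assms(3) by (intro poly_mapping_eqI) (simp add: lookup_add lookup_minus)
  moreover have "monomial ((n - m) + m) \<in> I"
    unfolding monomial_add
    using assms(2) monomial_ideal_ideal[OF assms(1), unfolded mpoly_ideal_iff] by blast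
  ultimately show ?thesis
    by (rule ssubst)
qed

section \<open>The graded quotient\<close>

lemma residue_class_eq_iff:
  assumes "ideal I mpoly_ring"
  shows "residue_class I p = residue_class I q \<longleftrightarrow> p - q \<in> I"
proof -
  interpret cring "mpoly_ring :: ('a, 'b) mpoly ring" by (rule cring_mpoly_ring)
  show ?thesis
    using quotient_eq_iff_same_a_r_cos[OF assms, of p q] by (simp add: mpoly_ring_diff)
qed

lemma quotient_simps:
  assumes "ideal I mpoly_ring"
  shows "carrier (mpoly_ring Quot I) = range (residue_class I)"
    and "residue_class I p \<otimes>\<^bsub>mpoly_ring Quot I\<^esub> residue_class I q = residue_class I (p * q)"
    and "residue_class I p \<oplus>\<^bsub>mpoly_ring Quot I\<^esub> residue_class I q = residue_class I (p + q)"
    and "\<zero>\<^bsub>mpoly_ring Quot I\<^esub> = residue_class I 0"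
    and "\<one>\<^bsub>mpoly_ring Quot I\<^esub> = residue_class I 1"
proof -
  interpret ideal I mpoly_ring by (rule assms)
  interpret ring_hom_ring mpoly_ring "mpoly_ring Quot I" "residue_class I"
    by (rule rcos_ring_hom_ring)
  show "carrier (mpoly_ring Quot I) = range (residue_class I)"
    by (auto simp: FactRing_def A_RCOSETS_def')
  show "residue_class I p \<otimes>\<^bsub>mpoly_ring Quot I\<^esub> residue_class I q = residue_class I (p * q)"
    using hom_mult[of p q] by simp
  show "residue_class I p \<oplus>\<^bsub>mpoly_ring Quot I\<^esub> residue_class I q = residue_class I (p + q)"
    using hom_add[of p q] by simp
  show "\<zero>\<^bsub>mpoly_ring Quot I\<^esub> = residue_class I 0"
    using hom_zero by simp
  show "\<one>\<^bsub>mpoly_ring Quot I\<^esub> = residue_class I 1"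
    using hom_one by simp
qed

lemma const_add: "const (c + d) = const c + const d"
  by (simp add: const_def single_add)

lemma const_mult: "const (c * d) = const c * const d"
  by (simp add: const_def mult_single)

lemma const_one [simp]: "const 1 = 1"
  by (simp add: const_def)

lemma one_notin_proper_ideal:
  assumes "ideal I mpoly_ring" "I \<noteq> carrier mpoly_ring"
  shows "1 \<notin> I"
  using ideal.one_imp_carrier[OF assms(1)] assms(2) by auto

text \<open>The composite k -> P -> P/I is a ring homomorphism from a field, and properness of
  \<open>I\<close> gives 1 \<noteq> 0 in the quotient, so its image is a field.\<close>

lemma subfield_scalars:
  fixes I :: "('x::finite, 'k::field) mpoly set"
  assumes I: "ideal I mpoly_ring" "I \<noteq> carrier mpoly_ring"
  shows "subfield (scalars I) (mpoly_ring Quot I)"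
proof -
  interpret k: field "ring_of_type_algebra :: 'k ring" by (rule field_from_type_algebra)
  interpret R: ring "mpoly_ring Quot I" by (rule ideal.quotient_is_ring[OF I(1)])
  interpret ring_hom_ring "ring_of_type_algebra :: 'k ring" "mpoly_ring Quot I" "residue_class I \<circ> const"
    by (intro ring_hom_ringI k.ring_axioms R.ring_axioms)
      (simp_all add: quotient_simps[OF I(1)] const_add const_mult)
  have "\<one>\<^bsub>mpoly_ring Quot I\<^esub> \<noteq> \<zero>\<^bsub>mpoly_ring Quot I\<^esub>"
    using one_notin_proper_ideal[OF I] by (simp add: quotient_simps[OF I(1)] residue_class_eq_iff[OF I(1)])
  from img_is_subfield(2)[OF k.carrier_is_subfield this] show ?thesis
    by (simp add: scalars_def image_comp)
qed

text \<open>Each line extension in the recursion of \<open>Span\<close> adjoins the possible terms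
  at one more exponent. For a list of all exponents of one degree the right-hand side is the graded
  piece.\<close>

lemma Span_monomials:
  fixes I :: "('x::finite, 'k::field) mpoly set"
  assumes I: "ideal I mpoly_ring"
  shows "ring.Span (mpoly_ring Quot I) (scalars I) (map (residue_class I \<circ> monomial) ms) =
    residue_class I ` {p. Poly_Mapping.keys p \<subseteq> set ms}"
proof -
  interpret R: ring "mpoly_ring Quot I" by (rule ideal.quotient_is_ring[OF I])
  show ?thesis
  proof (induction ms)
    case Nil
    then show ?case by (simp add: quotient_simps[OF I])
  next
    case (Cons m ms)
    have "residue_class I ` {p. Poly_Mapping.keys p \<subseteq> insert m (set ms)} =
      R.line_extension (scalars I) (residue_class I (monomial m))
        (residue_class I ` {p. Poly_Mapping.keys p \<subseteq> set ms})" (is "?L = ?R")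
    proof (rule equalityI; rule subsetI)
      fix u assume "u \<in> ?L"
      then obtain p where p: "Poly_Mapping.keys p \<subseteq> insert m (set ms)" and u: "u = residue_class I p"
        by blast
      define c where "c = const (Poly_Mapping.lookup p m) * monomial m"
      have "Poly_Mapping.keys (p - c) \<subseteq> set ms"
        using p by (auto simp: c_def in_keys_iff lookup_minus lookup_const_times monomial_def
            lookup_single when_def split: if_splits)
      moreover have "u = residue_class I (const (Poly_Mapping.lookup p m)) \<otimes>\<^bsub>mpoly_ring Quot I\<^esub>
          residue_class I (monomial m) \<oplus>\<^bsub>mpoly_ring Quot I\<^esub> residue_class I (p - c)"
        by (simp add: u quotient_simps[OF I] c_def)
      ultimately show "u \<in> ?R"
        unfolding R.line_extension_mem_iff scalars_def by blast
    next
      fix u assume "u \<in> ?R"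
      then obtain c p where p: "Poly_Mapping.keys p \<subseteq> set ms"
        and u: "u = residue_class I (const c) \<otimes>\<^bsub>mpoly_ring Quot I\<^esub>
          residue_class I (monomial m) \<oplus>\<^bsub>mpoly_ring Quot I\<^esub> residue_class I p"
        unfolding R.line_extension_mem_iff scalars_def by blast
      have "Poly_Mapping.keys (const c * monomial m + p) \<subseteq> insert m (set ms)"
        using p by (auto simp: in_keys_iff lookup_add lookup_const_times monomial_def
            lookup_single when_def split: if_splits)
      moreover have "u = residue_class I (const c * monomial m + p)"
        by (simp add: u quotient_simps[OF I])
      ultimately show "u \<in> ?L"
        by blast
    qed
    then show ?case
      using Cons.IH by simp
  qed
qed

lemma finite_dimension_graded_piece:
  fixes I :: "('x::finite, 'k::field) mpoly set"
  assumes I: "ideal I mpoly_ring" "I \<noteq> carrier mpoly_ring"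
  shows "ring.finite_dimension (mpoly_ring Quot I) (scalars I) (graded_piece I d)"
proof -
  interpret R: ring "mpoly_ring Quot I" by (rule ideal.quotient_is_ring[OF I(1)])
  obtain ms where ms: "set ms = {m :: 'x \<Rightarrow>\<^sub>0 nat. monomial_degree m = d}"
    using finite_list[OF finite_monomial_degree] by blast
  have "graded_piece I d = R.Span (scalars I) (map (residue_class I \<circ> monomial) ms)"
    unfolding Span_monomials[OF I(1)] ms graded_piece_def homogeneous_def
    by (rule arg_cong[where f = "(`) (residue_class I)"]) auto
  moreover have "set (map (residue_class I \<circ> monomial) ms) \<subseteq> carrier (mpoly_ring Quot I)"
    by (auto simp: quotient_simps[OF I(1)])
  ultimately show ?thesis
    using R.Span_finite_dimension[OF subfield_scalars[OF I]] by simp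
qed

section \<open>Dimension of the image of a multiplication\<close>

text \<open>Multiplication by \<open>x\<close> is linear over \<open>K\<close> and so carries a line
  extension to a line extension; injectivity keeps the image of the new vector \<open>v\<close>
  outside the image of \<open>E\<close>.\<close>

lemma (in cring) dimension_mult_inj:
  assumes K: "subfield K R" and x: "x \<in> carrier R"
    and "dimension n K E" "inj_on ((\<otimes>) x) E"
  shows "dimension n K ((\<otimes>) x ` E)"
  using assms(3,1,4)
proof (induction rule: dimension.induct)
  case zero_dim
  then show ?case using x by simp
next
  case (Suc_dim v E n K)
  note K = \<open>subfield K R\<close>
  have E: "E \<subseteq> carrier R" "\<zero> \<in> E"
    using space_subgroup_props(1,2)[OF K Suc_dim.hyps(3)] .
  have Kc: "K \<subseteq> carrier R" "\<zero> \<in> K" "\<one> \<in> K"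
    using subfieldE(3)[OF K] subringE(2,3)[OF subfieldE(1)[OF K]] by auto
  have "v = \<one> \<otimes> v \<oplus> \<zero>"
    using Suc_dim.hyps(1) by simp
  then have v: "v \<in> line_extension K v E"
    using Kc(3) E(2) unfolding line_extension_mem_iff by blast
  have sub: "E \<subseteq> line_extension K v E"
  proof
    fix e assume e: "e \<in> E"
    then have "e = \<zero> \<otimes> v \<oplus> e"
      using E(1) Suc_dim.hyps(1) by auto
    then show "e \<in> line_extension K v E"
      using e Kc(2) unfolding line_extension_mem_iff by blast
  qed
  have notin: "x \<otimes> v \<notin> (\<otimes>) x ` E"
    using inj_on_image_mem_iff[OF Suc_dim.prems(2) v sub] Suc_dim.hyps(2) by simp
  have dim: "dimension n K ((\<otimes>) x ` E)"
    using Suc_dim.IH[OF K inj_on_subset[OF Suc_dim.prems(2) sub]] .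
  have dist: "x \<otimes> (k \<otimes> v \<oplus> e) = k \<otimes> (x \<otimes> v) \<oplus> x \<otimes> e" if "k \<in> K" "e \<in> E" for k e
    using that x Suc_dim.hyps(1) Kc(1) E(1) by (simp add: r_distr m_lcomm subsetD)
  have "(\<otimes>) x ` line_extension K v E = line_extension K (x \<otimes> v) ((\<otimes>) x ` E)"
  proof (rule equalityI; rule subsetI)
    fix y assume "y \<in> (\<otimes>) x ` line_extension K v E"
    then obtain w where "w \<in> line_extension K v E" and y: "y = x \<otimes> w"
      by (rule imageE)
    then obtain k e where "k \<in> K" "e \<in> E" "w = k \<otimes> v \<oplus> e"
      unfolding line_extension_mem_iff by blast
    then show "y \<in> line_extension K (x \<otimes> v) ((\<otimes>) x ` E)"
      unfolding line_extension_mem_iff y using dist by blast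
  next
    fix y assume "y \<in> line_extension K (x \<otimes> v) ((\<otimes>) x ` E)"
    then obtain k e where ke: "k \<in> K" "e \<in> E" and "y = k \<otimes> (x \<otimes> v) \<oplus> x \<otimes> e"
      unfolding line_extension_mem_iff by blast
    then have "y = x \<otimes> (k \<otimes> v \<oplus> e)"
      by (simp add: dist)
    then show "y \<in> (\<otimes>) x ` line_extension K v E"
      by (rule image_eqI) (use ke in \<open>auto simp: line_extension_mem_iff\<close>)
  qed
  then show ?case
    using dimension.Suc_dim[OF _ notin dim] x Suc_dim.hyps(1) by simp
qed

text \<open>Rank-nullity for a kernel that is the line through \<open>q\<close>. Completing
  \<open>[q]\<close> to a basis \<open>Vs @ [q]\<close> makes the span of \<open>Vs\<close> a
  complement of the kernel: multiplication by \<open>x\<close> is injective there and already has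
  the full image.\<close>

lemma (in cring) dimension_mult_image:
  assumes K: "subfield K R" and x: "x \<in> carrier R"
    and dim: "dimension n K E" and q: "q \<in> E" "q \<noteq> \<zero>" "x \<otimes> q = \<zero>"
    and ker: "\<And>v. v \<in> E \<Longrightarrow> x \<otimes> v = \<zero> \<Longrightarrow> \<exists>k\<in>K. v = k \<otimes> q"
  shows "\<exists>m. n = Suc m \<and> dimension m K ((\<otimes>) x ` E)"
proof -
  have E: "E \<subseteq> carrier R"
    using space_subgroup_props(1)[OF K dim] .
  have Kc: "K \<subseteq> carrier R"
    using subfieldE(3)[OF K] .
  have "independent K [q]"
    using q E by (auto intro: li_Cons)
  then obtain Vs where Vs: "length (Vs @ [q]) = n" "independent K (Vs @ [q])" "Span K (Vs @ [q]) = E"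
    using complete_base[OF K dim, of "[q]"] q by auto
  note split = independent_split[OF K Vs(2)]
  have Vsc: "set Vs \<subseteq> carrier R" and qc: "set [q] \<subseteq> carrier R"
    using independent_in_carrier[OF Vs(2)] by auto
  note sub = Span_subgroup_props[OF K Vsc]
  have EV: "E = Span K Vs <+> Span K [q]"
    using Span_append_eq_set_add[OF K Vsc qc] Vs(3) by simp
  have Sq: "u \<in> Span K [q] \<longleftrightarrow> (\<exists>k\<in>K. u = k \<otimes> q)" for u
  proof -
    have "k \<otimes> q \<oplus> \<zero> = k \<otimes> q" if "k \<in> K" for k
      using that Kc qc by auto
    then show ?thesis
      by (simp add: line_extension_mem_iff cong: bex_cong)
  qed
  have xq: "x \<otimes> u = \<zero>" if "u \<in> Span K [q]" for u
    using that q x Kc qc unfolding Sq by (auto simp: m_lcomm subsetD)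
  have VE: "Span K Vs \<subseteq> E"
    using mono_Span_append(1)[OF K Vsc qc] Vs(3) by simp
  have "inj_on ((\<otimes>) x) (Span K Vs)"
  proof (rule inj_onI)
    fix u w assume uw: "u \<in> Span K Vs" "w \<in> Span K Vs" "x \<otimes> u = x \<otimes> w"
    have "u \<in> carrier R" "w \<in> carrier R"
      using uw sub(1) by auto
    moreover have "u \<ominus> w \<in> Span K Vs"
      using uw sub by (simp add: a_minus_def)
    moreover have "x \<otimes> (u \<ominus> w) = \<zero>"
      using uw(3) x calculation by (simp add: a_minus_def r_distr r_minus r_neg)
    ultimately have "u \<ominus> w \<in> Span K Vs \<inter> Span K [q]"
      using ker VE Sq by blast
    then have "u \<ominus> w = \<zero>"
      unfolding split(3) by simp
    then show "u = w"
      using \<open>u \<in> carrier R\<close> \<open>w \<in> carrier R\<close> by simp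
  qed
  then have "dimension (length Vs) K ((\<otimes>) x ` Span K Vs)"
    using dimension_mult_inj[OF K x] dimension_independent[OF split(2)] by blast
  moreover have "(\<otimes>) x ` E = (\<otimes>) x ` Span K Vs"
  proof
    show "(\<otimes>) x ` Span K Vs \<subseteq> (\<otimes>) x ` E"
      using VE by blast
    show "(\<otimes>) x ` E \<subseteq> (\<otimes>) x ` Span K Vs"
    proof
      fix y assume "y \<in> (\<otimes>) x ` E"
      then obtain v u where "v \<in> Span K Vs" "u \<in> Span K [q]" "y = x \<otimes> (v \<oplus> u)"
        unfolding EV set_add_def' by blast
      moreover have "v \<in> carrier R" "u \<in> carrier R"
        using calculation sub(1) Span_in_carrier[OF Kc qc] by blast+
      ultimately show "y \<in> (\<otimes>) x ` Span K Vs"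
        using xq x by (auto simp: r_distr)
    qed
  qed
  ultimately show ?thesis
    using Vs(1) by (intro exI[of _ "length Vs"]) (simp del: Span.simps)
qed

section \<open>Exact zero divisors modulo monomial ideals\<close>

text \<open>A polynomial nonzero at some \<open>u\<close> stays nonzero when restricted to a line
  through \<open>u\<close>. Its restriction \<open>P\<close>, multiplied by the restricted
  coordinates, has finitely many roots, while the field is infinite.\<close>

lemma zariski_open_torus:
  fixes U :: "('x::finite \<Rightarrow> 'k::field_char_0) set"
  assumes "zariski_open U" "U \<noteq> {}"
  obtains a where "a \<in> U" "\<And>i. a i \<noteq> 0"
proof -
  obtain F where F: "U = - zero_locus F"
    using assms(1) by (auto simp: zariski_open_def)
  with assms(2) obtain u p where p: "p \<in> F" "mpoly_eval p u \<noteq> 0"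
    by (auto simp: zero_locus_def)
  define P where "P = (\<Sum>m\<in>Poly_Mapping.keys p.
    Polynomial.smult (Poly_Mapping.lookup p m) (\<Prod>i\<in>UNIV. [:u i, 1:] ^ Poly_Mapping.lookup m i))"
  \<comment> \<open>The line through \<open>u\<close> in direction \<open>(1, \<dots>, 1)\<close> lies in no coordinate hyperplane.\<close>
  define N where "N = P * (\<Prod>i\<in>UNIV. [:u i, 1:])"
  have P: "Polynomial.poly P t = mpoly_eval p (\<lambda>i. u i + t)" for t
    by (simp add: P_def mpoly_eval_def poly_sum poly_prod)
  then have "P \<noteq> 0"
    using p(2) by (metis (no_types, lifting) add.right_neutral poly_0 ext)
  then have "N \<noteq> 0"
    by (simp add: N_def)
  then have "finite {t. Polynomial.poly N t = 0}"
    by (rule poly_roots_finite)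
  then obtain t where "Polynomial.poly N t \<noteq> 0"
    using infinite_UNIV_char_0 by (metis (mono_tags, lifting) UNIV_eq_I mem_Collect_eq)
  then have "mpoly_eval p (\<lambda>i. u i + t) \<noteq> 0" "\<And>i. u i + t \<noteq> 0"
    by (simp_all add: N_def poly_prod P)
  then show thesis
    using p(1) that[of "\<lambda>i. u i + t"] by (auto simp: F zero_locus_def)
qed

text \<open>An exponent \<open>M\<close> of the product outside \<open>I\<close> is a sum m + s of
  exponents of \<open>q\<close> and \<open>p\<close>. Nothing below \<open>M\<close> lies in
  \<open>I\<close>, so multiplying \<open>q\<close> by the linear form gives zero coefficients on
  that box, and the coefficient of \<open>q\<close> at m must vanish, a contradiction.\<close>

lemma linear_form_kernel_annihilates:
  fixes I :: "('x::finite, 'k::field_char_0) mpoly set"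
  assumes I: "monomial_ideal I" and a: "\<And>i. a i \<noteq> 0"
    and q: "homogeneous e q" "linear_form a * q \<in> I" and p: "homogeneous (Suc e) p"
  shows "q * p \<in> I"
proof (rule monomial_ideal_memI[OF I], rule ccontr)
  fix M assume "M \<in> Poly_Mapping.keys (q * p)" and M: "monomial M \<notin> I"
  then obtain m s where m: "m \<in> Poly_Mapping.keys q" and s: "s \<in> Poly_Mapping.keys p" and ms: "M = m + s"
    using keys_mult[of q p] by blast
  have deg: "monomial_degree m = e" "monomial_degree s = Suc e"
    using q(1) p m s by (auto simp: homogeneous_def)
  have "Poly_Mapping.lookup q m = 0"
  \<comment> \<open>The degrees e and e + 1 add up to 2e + 1, which is precisely the degree of
    \<open>M\<close> required for weight -1 in degree e.\<close>
  proof (rule raise_kernel_below[of a M "Suc e"])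
    fix n assume "\<And>i. Poly_Mapping.lookup n i \<le> Poly_Mapping.lookup M i"
    then have "monomial n \<notin> I"
      using monomial_ideal_upward[OF I] M by blast
    then have "n \<notin> Poly_Mapping.keys (linear_form a * q)"
      using q(2) monomial_ideal_memD[OF I] by blast
    then show "raise a (Poly_Mapping.lookup q) n = 0"
      by (simp add: in_keys_iff lookup_linear_form_times)
  qed (simp_all add: a deg ms lookup_add monomial_degree_add)
  with m show False
    by (simp add: in_keys_iff)
qed

text \<open>A cofactor obtained from a principal ideal need not be homogeneous. In degree e + 1 the
  product sees only its part of degree e, and the truncated difference has no terms in other
  degrees.\<close>

lemma linear_form_preimage_homogeneous:
  assumes I: "monomial_ideal I" and p: "homogeneous (Suc e) p" "p - linear_form a * g \<in> I"
  shows "p - linear_form a * homogeneous_part e g \<in> I"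
proof (rule monomial_ideal_memI[OF I])
  fix m assume m: "m \<in> Poly_Mapping.keys (p - linear_form a * homogeneous_part e g)"
  have "homogeneous (Suc e) (linear_form a * homogeneous_part e g)"
    using homogeneous_mult[OF homogeneous_linear_form homogeneous_homogeneous_part] by simp
  then have deg: "monomial_degree m = Suc e"
    using m homogeneous_minus[OF p(1)] by (auto simp: homogeneous_def)
  then have "raise a (Poly_Mapping.lookup (homogeneous_part e g)) m = raise a (Poly_Mapping.lookup g) m"
    by (intro raise_cong) (simp add: lookup_homogeneous_part)
  with m have "m \<in> Poly_Mapping.keys (p - linear_form a * g)"
    by (simp add: in_keys_iff lookup_minus lookup_linear_form_times)
  with p(2) show "monomial m \<in> I"
    using monomial_ideal_memD[OF I] by blast
qed

text \<open>Since \<open>q\<close> is homogeneous of degree e, only the constant term of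
  \<open>f\<close> contributes to \<open>f * q\<close> in degree e. Hence the degree-e part of the
  ideal generated by \<open>q\<close> modulo \<open>I\<close> is spanned by \<open>q\<close> over
  the scalars.\<close>

lemma homogeneous_multiple_scalar:
  assumes I: "monomial_ideal I" and g: "homogeneous e g" and q: "homogeneous e q" and "g - f * q \<in> I"
  shows "g - const (Poly_Mapping.lookup f 0) * q \<in> I"
proof (rule monomial_ideal_memI[OF I])
  let ?c = "const (Poly_Mapping.lookup f 0)"
  fix m assume m: "m \<in> Poly_Mapping.keys (g - ?c * q)"
  have "homogeneous 0 ?c"
    by (simp add: homogeneous_def const_def)
  then have "homogeneous e (?c * q)"
    using homogeneous_mult[OF _ q] by fastforce
  then have deg: "monomial_degree m = e"
    using m homogeneous_minus[OF g] by (auto simp: homogeneous_def)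
  have "m \<notin> Poly_Mapping.keys ((f - ?c) * q)"
  proof
    assume "m \<in> Poly_Mapping.keys ((f - ?c) * q)"
    then obtain u v where uv: "m = u + v" "u \<in> Poly_Mapping.keys (f - ?c)" "v \<in> Poly_Mapping.keys q"
      using keys_mult[of "f - ?c" q] by blast
    then have "u = 0"
      using q deg by (simp add: homogeneous_def monomial_degree_add)
    with uv(2) show False
      by (simp add: in_keys_iff lookup_minus const_def)
  qed
  then have "Poly_Mapping.lookup (f * q) m = Poly_Mapping.lookup (?c * q) m"
    by (simp add: in_keys_iff lookup_minus left_diff_distrib)
  with m have "m \<in> Poly_Mapping.keys (g - f * q)"
    by (simp add: in_keys_iff lookup_minus)
  with assms(4) show "monomial m \<in> I"
    using monomial_ideal_memD[OF I] by blast
qed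

theorem theorem3p2:
  fixes I :: "('x::finite, 'k::{alg_closed_field, field_char_0}) mpoly set"
    and U :: "('x \<Rightarrow> 'k) set"
    and d :: nat
  assumes "monomial_ideal I"
    and "I \<noteq> carrier mpoly_ring"
    and "d > 0"
    and "zariski_open U" and "U \<noteq> {}"
    and "\<And>a. a \<in> U \<Longrightarrow>
      \<exists>Q\<in>graded_piece I (d - 1).
        exact_zero_divisors (mpoly_ring Quot I) (residue_class I (linear_form a)) Q"
  shows "int (graded_dim I d) = int (graded_dim I (d - 1)) - 1"
proof -
  let ?h = "residue_class I" and ?R = "mpoly_ring Quot I"
  obtain e where e: "d = Suc e"
    using assms(3) gr0_implies_Suc by blast
  have I: "ideal I mpoly_ring"
    by (rule monomial_ideal_ideal[OF assms(1)])
  note K = subfield_scalars[OF I assms(2)]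
  interpret R: cring ?R
    by (rule ideal.quotient_is_cring[OF I cring_mpoly_ring])
  note quot = quotient_simps[OF I] and eq_iff = residue_class_eq_iff[OF I]
  \<comment> \<open>Nonzero coordinates are required because \<open>lower\<close> divides by
    them.\<close>
  obtain a where a: "a \<in> U" "\<And>i. a i \<noteq> 0"
    using zariski_open_torus[OF assms(4,5)] by blast
  let ?l = "linear_form a"
  obtain q where q: "homogeneous e q"
    and "exact_zero_divisors ?R (?h ?l) (?h q)"
    using assms(6)[OF a(1)] by (auto simp: e graded_piece_def)
  then have ann: "annihilator ?R (?h ?l) = PIdl\<^bsub>?R\<^esub> (?h q)" "annihilator ?R (?h q) = PIdl\<^bsub>?R\<^esub> (?h ?l)"
    by (simp_all add: exact_zero_divisors_def)
  \<comment> \<open>The exactness conditions are pulled back from cosets to congruences modulo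
    \<open>I\<close>, giving \<open>ker_l\<close> and \<open>ker_q\<close>.\<close>
  have mem_PIdl: "?h g \<in> PIdl\<^bsub>?R\<^esub> (?h p) \<longleftrightarrow> (\<exists>f. g - f * p \<in> I)" for g p
  proof -
    have "?h g \<in> PIdl\<^bsub>?R\<^esub> (?h p) \<longleftrightarrow> (\<exists>f. ?h g = ?h f \<otimes>\<^bsub>?R\<^esub> ?h p)"
      unfolding cgenideal_def quot(1) by blast
    then show ?thesis
      by (simp add: quot eq_iff)
  qed
  have mem_ann: "?h g \<in> annihilator ?R (?h p) \<longleftrightarrow> p * g \<in> I" for g p
    by (auto simp: annihilator_def quot eq_iff)
  have ker_l: "?l * g \<in> I \<longleftrightarrow> (\<exists>f. g - f * q \<in> I)" for g
    unfolding mem_ann[symmetric] ann(1) by (rule mem_PIdl)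
  have ker_q: "q * g \<in> I \<longleftrightarrow> (\<exists>f. g - f * ?l \<in> I)" for g
    unfolding mem_ann[symmetric] ann(2) by (rule mem_PIdl)
  have I0: "0 \<in> I"
    using I by (simp add: mpoly_ideal_iff)
  have lq: "?l * q \<in> I"
    unfolding ker_l using I0 by (intro exI[of _ 1]) simp
  \<comment> \<open>Otherwise 1 would annihilate the class of \<open>q\<close>, so 1 would be a
    multiple of the linear form modulo \<open>I\<close>. Comparing constant terms puts 1 into
    \<open>I\<close>.\<close>
  have "q \<notin> I"
  proof
    assume "q \<in> I"
    then have "q * 1 \<in> I" by simp
    then obtain f where "1 - f * ?l \<in> I"
      unfolding ker_q by blast
    moreover have "Poly_Mapping.lookup (1 - f * ?l) 0 = 1"
      by (simp add: lookup_minus mult.commute[of f] lookup_linear_form_times raise_def)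
    then have "0 \<in> Poly_Mapping.keys (1 - f * ?l)"
      by (simp add: in_keys_iff)
    ultimately have "monomial 0 \<in> I"
      by (rule monomial_ideal_memD[OF assms(1)])
    then show False
      using one_notin_proper_ideal[OF I assms(2)] by (simp add: monomial_def)
  qed
  \<comment> \<open>Surjectivity onto degree \<open>d\<close>: the annihilator of \<open>q\<close>
    contains every form of degree \<open>d\<close> and equals the ideal of the linear form; the
    cofactor is then cut down to degree e.\<close>
  have image: "graded_piece I d = (\<otimes>\<^bsub>?R\<^esub>) (?h ?l) ` graded_piece I e"
  proof (rule equalityI; rule subsetI)
    fix u assume "u \<in> graded_piece I d"
    then obtain p where p: "homogeneous (Suc e) p" "u = ?h p"
      by (auto simp: graded_piece_def e)
    have "q * p \<in> I"
      by (rule linear_form_kernel_annihilates[OF assms(1) a(2) q lq p(1)])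
    then obtain g where "p - ?l * g \<in> I"
      unfolding ker_q by (auto simp: mult.commute)
    then have "p - ?l * homogeneous_part e g \<in> I"
      by (rule linear_form_preimage_homogeneous[OF assms(1) p(1)])
    then have "u = ?h ?l \<otimes>\<^bsub>?R\<^esub> ?h (homogeneous_part e g)"
      by (simp add: p(2) quot eq_iff)
    then show "u \<in> (\<otimes>\<^bsub>?R\<^esub>) (?h ?l) ` graded_piece I e"
      using homogeneous_homogeneous_part unfolding graded_piece_def by blast
  next
    fix u assume "u \<in> (\<otimes>\<^bsub>?R\<^esub>) (?h ?l) ` graded_piece I e"
    then obtain g where "homogeneous e g" "u = ?h (?l * g)"
      by (auto simp: graded_piece_def quot)
    then show "u \<in> graded_piece I d"
      using homogeneous_mult[OF homogeneous_linear_form, of e g a] by (auto simp: graded_piece_def e)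
  qed
  obtain n where n: "R.dimension n (scalars I) (graded_piece I e)"
    using finite_dimension_graded_piece[OF I assms(2)] by (auto simp: R.finite_dimension_def)
  \<comment> \<open>The kernel in degree e is the line through the nonzero class of
    \<open>q\<close>, so the image loses exactly one dimension.\<close>
  have "\<exists>m. n = Suc m \<and> R.dimension m (scalars I) ((\<otimes>\<^bsub>?R\<^esub>) (?h ?l) ` graded_piece I e)"
  proof (rule R.dimension_mult_image[OF K _ n])
    show "?h ?l \<in> carrier ?R" by (simp add: quot)
    show "?h q \<in> graded_piece I e" using q by (simp add: graded_piece_def)
    show "?h q \<noteq> \<zero>\<^bsub>?R\<^esub>" using \<open>q \<notin> I\<close> by (simp add: quot eq_iff)
    show "?h ?l \<otimes>\<^bsub>?R\<^esub> ?h q = \<zero>\<^bsub>?R\<^esub>" using lq by (simp add: quot eq_iff)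
  next
    fix v assume "v \<in> graded_piece I e" and v: "?h ?l \<otimes>\<^bsub>?R\<^esub> v = \<zero>\<^bsub>?R\<^esub>"
    then obtain g where g: "homogeneous e g" "v = ?h g"
      by (auto simp: graded_piece_def)
    then obtain f where "g - f * q \<in> I"
      using v ker_l by (auto simp: quot eq_iff)
    then have "v = ?h (const (Poly_Mapping.lookup f 0)) \<otimes>\<^bsub>?R\<^esub> ?h q"
      using homogeneous_multiple_scalar[OF assms(1) g(1) q] by (simp add: g(2) quot eq_iff)
    then show "\<exists>k\<in>scalars I. v = k \<otimes>\<^bsub>?R\<^esub> ?h q"
      unfolding scalars_def by blast
  qed
  then obtain m where "n = Suc m" "R.dimension m (scalars I) (graded_piece I d)"
    unfolding image by blast
  then show ?thesis
    using R.dimI[OF K] n by (simp add: graded_dim_def e over_def)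
qed

end
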